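(* Fix $d\geq1$, $X=\mathbb{N}^d$, $\Gamma=\mathbb{N}^d$. Let $x_0\in X$ and let $\Gamma'$ be a subsemigroup of $\Gamma$ freely generated by $a^{(1)},\dots,a^{(r)}$. Then $$\sum_{x\in\Gamma'\cdot x_0}\mathrm{Cont}(x)=\mathrm{Cont}(x_0)\prod_{i=1}^r\frac{1}{1-\mathrm{Cont}(a^{(i)})},$$ where $\Gamma'\cdot x_0=\{g^a(x_0):a\in\Gamma'\}$ and, for $a=(a_1,\dots,a_d)\in\Gamma$, $\mathrm{Cont}(a)=t^{a_1+\dots+a_d}q^{0a_1+1a_2+\dots+(d-1)a_d}$.
   Context: For $x=(n_1,\dots,n_d)\in X$: $n(x)=\sum n_i$, $\Delta(x)=\{(1,n_1),\dots,(d,n_d)\}\subseteq[d]\times\mathbb{N}$ (conversely $d$ points with distinct first coordinates determine an element of $X$). For $\delta=(i,n)$, seat $i(\delta)=i$, height $h(\delta)=n+i/d$; points ordered by height; $\delta+s/d$ is the point of height $h(\delta)+s/d$. $\Delta(x)=\{\delta^1(x)\prec\cdots\prec\delta^d(x)\}$. $W(x)=\sum_{j<k}\lfloor h(\delta^k(x))-h(\delta^j(x))\rfloor$, and $\mathrm{Cont}(x)=t^{n(x)}q^{W(x)}\in\mathbb{Z}[[t,q]]$. Operator $g_j:X\to X$ ($j\in[d]$): $g_j(x)=x'$ with $\delta^k(x')=\delta^k(x)$ for $k<j$ and $\delta^k(x')=\delta^k(x)+s_k/d$ for $k\geq j$, $s_k$ the smallest positive integer with the seat of $\delta^k(x)+s_k/d$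 in $\{i(\delta^j(x)),\dots,i(\delta^d(x))\}$. For $a\in\Gamma$, $g^a=g_1^{a_1}\circ\cdots\circ g_d^{a_d}$. *)

theory Defs
  imports
    "HOL-Analysis.Infinite_Sum"
    "HOL-Computational_Algebra.Formal_Power_Series"
begin

text \<open>The set \<open>\<nat>\<^sup>d\<close>, used both for \<open>X\<close> and for \<open>\<Gamma>\<close>. Tuples are indexed by \<open>{1..d}\<close> and
  extended by \<open>0\<close>, so that distinct elements are distinct functions and the addition of \<open>\<Gamma>\<close> is
  pointwise.\<close>

definition tuples :: "nat \<Rightarrow> (nat \<Rightarrow> nat) set" where
  "tuples d = {x. \<forall>i. i \<notin> {1..d} \<longrightarrow> x i = 0}"

text \<open>Points \<open>(i, n)\<close> of \<open>{1..d} \<times> \<nat>\<close>.\<close>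

type_synonym point = "nat \<times> nat"

definition seat :: "point \<Rightarrow> nat" where
  "seat p = fst p"

definition height :: "nat \<Rightarrow> point \<Rightarrow> real" where
  "height d p = real (snd p) + real (fst p) / real d"

definition points :: "nat \<Rightarrow> (nat \<Rightarrow> nat) \<Rightarrow> point set" where
  "points d x = {(i, x i) | i. i \<in> {1..d}}"

text \<open>\<open>\<delta>\<^sup>k(x)\<close> for \<open>1 \<le> k \<le> d\<close>; the points have pairwise distinct heights (see \<open>height_inj\<close>).\<close>

definition delta :: "nat \<Rightarrow> (nat \<Rightarrow> nat) \<Rightarrow> nat \<Rightarrow> point" where
  "delta d x k = sorted_key_list_of_set (height d) (points d x) ! (k - 1)"

text \<open>\<open>\<delta> + s/d\<close>: the point of \<open>{1..d} \<times> \<nat>\<close> of height \<open>h(\<delta>) + s/d\<close>; see \<open>shift_props\<close> for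
  existence and uniqueness.\<close>

definition shift :: "nat \<Rightarrow> point \<Rightarrow> nat \<Rightarrow> point" where
  "shift d p s =
    (THE p'. seat p' \<in> {1..d} \<and> height d p' = height d p + real s / real d)"

definition total :: "nat \<Rightarrow> (nat \<Rightarrow> nat) \<Rightarrow> nat" where
  "total d x = (\<Sum>i = 1..d. x i)"

text \<open>For \<open>j < k\<close> the height difference is positive, so the conversion by \<open>nat\<close> loses nothing.\<close>

definition W :: "nat \<Rightarrow> (nat \<Rightarrow> nat) \<Rightarrow> nat" where
  "W d x = (\<Sum>(j, k) \<in> {(j, k). 1 \<le> j \<and> j < k \<and> k \<le> d}.
              nat \<lfloor>height d (delta d x k) - height d (delta d x j)\<rfloor>)"

text \<open>\<open>\<int>[[t,q]]\<close> is represented as \<open>\<int>[[q]][[t]]\<close>: the outer variable is \<open>t\<close>, the inner one \<open>q\<close>.\<close>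

definition tq_monom :: "nat \<Rightarrow> nat \<Rightarrow> int fps fps" where
  "tq_monom m n = fps_X ^ m * fps_const (fps_X ^ n)"

definition cont :: "nat \<Rightarrow> (nat \<Rightarrow> nat) \<Rightarrow> int fps fps" where
  "cont d x = tq_monom (total d x) (W d x)"

definition cont_\<Gamma> :: "nat \<Rightarrow> (nat \<Rightarrow> nat) \<Rightarrow> int fps fps" where
  "cont_\<Gamma> d a = tq_monom (\<Sum>j = 1..d. a j) (\<Sum>j = 1..d. (j - 1) * a j)"

definition step :: "nat \<Rightarrow> nat \<Rightarrow> (nat \<Rightarrow> nat) \<Rightarrow> nat \<Rightarrow> nat" where
  "step d j x k = (LEAST s. s > 0 \<and>
     seat (shift d (delta d x k) s) \<in> {seat (delta d x l) | l. l \<in> {j..d}})"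

definition g :: "nat \<Rightarrow> nat \<Rightarrow> (nat \<Rightarrow> nat) \<Rightarrow> (nat \<Rightarrow> nat)" where
  "g d j x = (THE x'. x' \<in> tuples d \<and>
     (\<forall>k \<in> {1..d}. delta d x' k =
        (if k < j then delta d x k else shift d (delta d x k) (step d j x k))))"

text \<open>\<open>g\<^sup>a = g\<^sub>1\<^bsup>a\<^sub>1\<^esup> \<circ> \<dots> \<circ> g\<^sub>d\<^bsup>a\<^sub>d\<^esup>\<close>\<close>

definition g_pow :: "nat \<Rightarrow> (nat \<Rightarrow> nat) \<Rightarrow> (nat \<Rightarrow> nat) \<Rightarrow> (nat \<Rightarrow> nat)" where
  "g_pow d a = foldr (\<lambda>j f. (g d j ^^ a j) \<circ> f) [1..<d + 1] id"

definition orbit :: "nat \<Rightarrow> (nat \<Rightarrow> nat) set \<Rightarrow> (nat \<Rightarrow> nat) \<Rightarrow> (nat \<Rightarrow> nat) set" where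
  "orbit d M x = {g_pow d a x | a. a \<in> M}"

text \<open>\<open>M\<close> is the free commutative semigroup (with \<open>0\<close>) on \<open>a 1, \<dots>, a r\<close>: every element of \<open>M\<close> is
  \<open>c\<^sub>1 a\<^sup>(\<^sup>1\<^sup>) + \<dots> + c\<^sub>r a\<^sup>(\<^sup>r\<^sup>)\<close> for a unique \<open>c \<in> \<nat>\<^sup>r\<close>, and all these combinations lie in \<open>M\<close>.\<close>

definition freely_generated_by ::
    "(nat \<Rightarrow> nat) set \<Rightarrow> nat \<Rightarrow> (nat \<Rightarrow> nat \<Rightarrow> nat) \<Rightarrow> bool" where
  "freely_generated_by M r a \<longleftrightarrow>
     bij_betw (\<lambda>c j. \<Sum>i = 1..r. c i * a i j) (tuples r) M"

text \<open>The multiplicative inverse in a commutative ring without a division operation, such as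
  \<open>\<int>[[t,q]]\<close>; only meaningful for units (cf. \<open>ring_inverse_fps\<close>).\<close>

definition ring_inverse :: "'a::comm_ring_1 \<Rightarrow> 'a" where
  "ring_inverse u = (THE v. u * v = 1)"

lemma ring_inverse_fps:
  fixes u :: "'a::comm_ring_1 fps"
  assumes "fps_nth u 0 = 1"
  shows "u * ring_inverse u = 1"
proof -
  have ex: "u * fps_right_inverse u 1 = 1"
    using assms by (intro fps_right_inverse) simp
  have "v = w" if "u * v = 1" "u * w = 1" for v w
    using that by (metis mult.assoc mult.commute mult.right_neutral)
  with ex show ?thesis
    unfolding ring_inverse_def by (metis (mono_tags, lifting) theI)
qed

lemma height_inj:
  assumes "d \<ge> 1" "seat p \<in> {1..d}" "seat p' \<in> {1..d}" "height d p = height d p'"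
  shows "p = p'"
proof -
  obtain i n i' n' where p: "p = (i, n)" "p' = (i', n')"
    by (cases p; cases p')
  have "real (d * n + i) = real (d * n' + i')"
    using assms(1,4) by (simp add: p height_def field_simps)
  then have eq: "d * n + (i - 1) = d * n' + (i' - 1)"
    using assms(2,3) unfolding of_nat_eq_iff by (auto simp: p seat_def)
  have lt: "i - 1 < d" "i' - 1 < d"
    using assms(2,3) by (auto simp: p seat_def)
  have "n = (d * n + (i - 1)) div d" "n' = (d * n' + (i' - 1)) div d"
    using lt by auto
  then have "n = n'"
    using eq by simp
  with eq assms(2,3) show ?thesis
    by (auto simp: p seat_def)
qed

lemma shift_props:
  assumes "d \<ge> 1" "seat p \<in> {1..d}"
  shows "seat (shift d p s) \<in> {1..d}"
    and "height d (shift d p s) = height d p + real s / real d"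
proof -
  define m where "m = fst p + s - 1"
  define p' where "p' = (m mod d + 1, snd p + m div d)"
  have m: "fst p + s = m + 1"
    using assms(2) by (auto simp: m_def seat_def)
  have seat: "seat p' \<in> {1..d}"
    using assms(1) by (auto simp: p'_def seat_def Suc_le_eq)
  have "real m = real d * real (m div d) + real (m mod d)"
    by (metis mult_div_mod_eq of_nat_add of_nat_mult)
  moreover have "real (fst p) + real s = real m + 1"
    using m by (metis of_nat_1 of_nat_add)
  ultimately have height: "height d p' = height d p + real s / real d"
    using assms(1) by (simp add: height_def p'_def field_simps)
  have "seat (shift d p s) \<in> {1..d} \<and> height d (shift d p s) = height d p + real s / real d"
    unfolding shift_def
    by (rule theI[where a = p']) (use seat height height_inj[OF assms(1)] in auto)
  then show "seat (shift d p s) \<in> {1..d}"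
    and "height d (shift d p s) = height d p + real s / real d"
    by blast+
qed

end

theory Submission
  imports Defs
begin

text \<open>
  Let \<open>S\<close> be the set of seats of \<open>\<delta>\<^sup>j(x), \<dots>, \<delta>\<^sup>d(x)\<close>. The operator \<open>g\<^sub>j\<close> moves each of these points to
  its immediate successor in \<open>S \<times> \<nat>\<close>, so it preserves their order and permutes their seats
  cyclically. Exactly one point wraps around, which raises \<open>n(x)\<close> by \<open>1\<close>. The floors in \<open>W\<close> between
  two moved points are unchanged, and for each of the \<open>j - 1\<close> fixed points the sum of the floors over the
  moved points grows by \<open>1\<close>. Hence \<open>g\<^sub>j\<close> multiplies the content by \<open>t q\<^bsup>j-1\<^esup>\<close> and
  \<open>Cont(g\<^sup>a x) = Cont(a) Cont(x)\<close>.

  The map \<open>a \<mapsto> g\<^sup>a x\<close> is injective: each \<open>g\<^sub>j\<close> is injective, and \<open>\<delta>\<^sup>1\<close> is moved by \<open>g\<^sub>1\<close> only, always upwards,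
  so its height determines \<open>a\<^sub>1\<close>; after cancelling the power of \<open>g\<^sub>1\<close> one continues with \<open>\<delta>\<^sup>2\<close> and \<open>a\<^sub>2\<close>,
  and so on. The sum over the orbit is therefore a product of geometric series. It converges
  in the \<open>t\<close>-adic topology because free generators are non-zero, so each \<open>Cont(a\<^sup>(\<^sup>i\<^sup>))\<close> is divisible by \<open>t\<close>.
\<close>

text \<open>Interpreting \<open>folding_insort_key\<close> at a type of class \<open>linorder\<close> yields the locale constant
  rather than the class constant.\<close>

lemma linorder_sorted_key_list_of_set_eq:
  "linorder.sorted_key_list_of_set (\<le>) (f :: 'b \<Rightarrow> 'a::linorder) = sorted_key_list_of_set f"
proof -
  have lin: "class.linorder (\<le>) ((<) :: 'a \<Rightarrow> 'a \<Rightarrow> bool)"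
    by (rule linorder_class.linorder_axioms)
  have "linorder.insort_key (\<le>) f x xs = insort_key f x xs" for x xs
    by (induction xs) (simp_all add: linorder.insort_key.simps[OF lin])
  then have "linorder.insort_key (\<le>) f = insort_key f" by (intro ext)
  then show ?thesis
    by (simp add: linorder.sorted_key_list_of_set_def[OF lin] sorted_key_list_of_set_def)
qed

text \<open>Transfers the uniqueness of strictly sorted lists from the folding locale to the class
  constant in which \<open>delta\<close> is defined.\<close>

lemma sorted_key_list_of_set_eq_iff:
  fixes f :: "'b \<Rightarrow> 'a::linorder"
  assumes "inj_on f A" "finite A"
  shows "sorted_key_list_of_set f A = l \<longleftrightarrow>
    sorted_wrt (<) (map f l) \<and> set l = A \<and> length l = card A"
proof -
  interpret folding_insort_key "(\<le>)" "(<)" A f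
    rewrites "linorder.sorted_key_list_of_set (\<le>) f = sorted_key_list_of_set f"
  proof -
    show "folding_insort_key (\<le>) (<) A f"
      by standard (rule assms(1))
  qed (rule linorder_sorted_key_list_of_set_eq)
  show ?thesis
    using sorted_key_list_of_set_unique[OF subset_refl assms(2), of l] by blast
qed

section \<open>Heights and cyclic successors\<close>

text \<open>Multiplied by \<open>d\<close>, heights become the integers \<open>d * n + i\<close>. As
  \<open>1 \<le> i \<le> d\<close>, a larger \<open>n\<close> outweighs any difference of
  seats.\<close>

lemma height_less_iff:
  assumes "d \<ge> 1" "fst p \<in> {1..d}" "fst q \<in> {1..d}"
  shows "height d p < height d q \<longleftrightarrow> snd p < snd q \<or> snd p = snd q \<and> fst p < fst q"
proof -
  have "height d p = real (d * snd p + fst p) / real d" for p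
    using assms(1) by (simp add: height_def field_simps)
  then have "height d p < height d q \<longleftrightarrow> real (d * snd p + fst p) < real (d * snd q + fst q)"
    using assms(1) by (simp only: divide_less_cancel) simp
  also have "\<dots> \<longleftrightarrow> d * snd p + fst p < d * snd q + fst q"
    by (rule of_nat_less_iff)
  also have "\<dots> \<longleftrightarrow> snd p < snd q \<or> snd p = snd q \<and> fst p < fst q"
  proof -
    have less: "d * m + i < d * n + i'" if "m < n" "i \<in> {1..d}" "i' \<in> {1..d}" for m n i i' :: nat
    proof -
      have "d * Suc m \<le> d * n" using that(1) by (intro mult_le_mono2) simp
      with that show ?thesis by simp
    qed
    show ?thesis
      using less[of "snd p" "snd q" "fst p" "fst q"] less[of "snd q" "snd p" "fst q" "fst p"] assms
      by (cases "snd p" "snd q" rule: linorder_cases) auto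
  qed
  finally show ?thesis .
qed

text \<open>The seats contribute a fraction strictly between -1 and 1, whose floor is -1 or 0. Thus
  \<open>W\<close> can be computed from the \<open>snd\<close> components and seat comparisons
  alone.\<close>

lemma floor_height_diff:
  assumes "d \<ge> 1" "fst p \<in> {1..d}" "fst q \<in> {1..d}"
  shows "\<lfloor>height d q - height d p\<rfloor> =
    int (snd q) - int (snd p) - of_bool (fst q < fst p)"
proof -
  define e where "e = real (fst q) / real d - real (fst p) / real d"
  have e: "e = (real (fst q) - real (fst p)) / real d"
    by (simp add: e_def diff_divide_distrib)
  have "\<lfloor>e\<rfloor> = - of_bool (fst q < fst p)"
    using assms by (intro floor_unique) (auto simp: e field_simps)
  moreover have "height d q - height d p = e + of_int (int (snd q) - int (snd p))"
    by (simp add: height_def e_def)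
  ultimately show ?thesis
    by (simp only: floor_add_int[symmetric])
qed

text \<open>The cyclic successor of \<open>i\<close> within \<open>S\<close>.\<close>

definition next_seat :: "nat set \<Rightarrow> nat \<Rightarrow> nat" where
  "next_seat S i = (if i = Max S then Min S else Min {s \<in> S. i < s})"

text \<open>The wrap from the largest seat to the smallest is paid for by one unit of
  \<open>snd\<close>, so that the height still increases.\<close>

definition next_point :: "nat set \<Rightarrow> point \<Rightarrow> point" where
  "next_point S p = (next_seat S (fst p), snd p + of_bool (fst p = Max S))"

lemma next_seat_greater:
  assumes "finite S" "i \<in> S" "i \<noteq> Max S"
  shows "next_seat S i \<in> S \<and> i < next_seat S i"
proof -
  have "Max S \<in> {s \<in> S. i < s}"
    using assms Max_ge[of S i] Max_in[of S] by (auto simp: order_less_le simp del: Max_in)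
  then have "Min {s \<in> S. i < s} \<in> {s \<in> S. i < s}"
    using assms by (intro Min_in) auto
  with assms show ?thesis by (simp add: next_seat_def)
qed

lemma next_seat_in: "finite S \<Longrightarrow> i \<in> S \<Longrightarrow> next_seat S i \<in> S"
  using next_seat_greater[of S i] Min_in[of S]
  by (cases "i = Max S") (auto simp: next_seat_def simp del: Min_in)

lemma next_seat_in_range:
  "S \<subseteq> {1..d} \<Longrightarrow> i \<in> S \<Longrightarrow> next_seat S i \<in> {1..d}"
  by (rule subsetD[OF _ next_seat_in[OF finite_subset[OF _ finite_atLeastAtMost]]])

lemma next_seat_le: "finite S \<Longrightarrow> s \<in> S \<Longrightarrow> i < s \<Longrightarrow> next_seat S i \<le> s"
  using Max_ge[of S s] by (auto simp: next_seat_def)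

lemma next_seat_Max_le: "finite S \<Longrightarrow> s \<in> S \<Longrightarrow> next_seat S (Max S) \<le> s"
  by (auto simp: next_seat_def)

text \<open>For \<open>i < k\<close>, either \<open>k\<close> wraps to \<open>Min S\<close>, which
  is at most \<open>i\<close> and hence below the successor of \<open>i\<close>, or the successor of
  \<open>i\<close> is at most \<open>k\<close> and hence below that of \<open>k\<close>.\<close>

lemma inj_on_next_seat: assumes "finite S" shows "inj_on (next_seat S) S"
proof -
  have neq: "next_seat S i \<noteq> next_seat S k" if "i \<in> S" "k \<in> S" "i < k" for i k
  proof -
    have i: "i \<noteq> Max S" using that Max_ge[OF assms that(2)] by auto
    show ?thesis
    proof (cases "k = Max S")
      case True
      with next_seat_Max_le[OF assms, of i] next_seat_greater[OF assms _ i] that show ?thesis by auto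
    next
      case False
      with next_seat_le[OF assms, of k i] next_seat_greater[OF assms _ False] that show ?thesis by auto
    qed
  qed
  show ?thesis
    by (rule inj_onI) (metis neq linorder_neqE_nat)
qed

lemma inj_on_next_point: assumes "finite S" shows "inj_on (next_point S) (S \<times> UNIV)"
  using inj_on_next_seat[OF assms]
  by (auto simp: inj_on_def next_point_def)

lemma bij_betw_next_seat: assumes "finite S" shows "bij_betw (next_seat S) S S"
  using assms endo_inj_surj[OF assms _ inj_on_next_seat[OF assms]] inj_on_next_seat[OF assms]
  by (auto simp: bij_betw_def next_seat_in image_subset_iff)

lemma height_next_point:
  assumes "d \<ge> 1" "S \<subseteq> {1..d}" "fst p \<in> S"
  shows "height d p < height d (next_point S p)"
proof -
  have S: "finite S" using assms(2) finite_subset by blast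
  with assms have "fst p \<in> {1..d}" "next_seat S (fst p) \<in> {1..d}"
    using next_seat_in by blast+
  with next_seat_greater[OF S assms(3)] assms(1) show ?thesis
    by (subst height_less_iff) (auto simp: next_point_def)
qed

text \<open>Together with \<open>height_next_point\<close> this makes \<open>next_point S p\<close>
  the immediate successor of \<open>p\<close> over \<open>S\<close>.\<close>

lemma next_point_least:
  assumes "d \<ge> 1" "S \<subseteq> {1..d}" "fst p \<in> S" "fst q \<in> S" "height d p < height d q"
  shows "height d (next_point S p) \<le> height d q"
proof -
  have S: "finite S" using assms(2) finite_subset by blast
  have in_d: "fst p \<in> {1..d}" "fst q \<in> {1..d}" "fst (next_point S p) \<in> {1..d}"
    using assms next_seat_in_range[OF assms(2)] by (auto simp: next_point_def simp del: atLeastAtMost_iff)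
  have "\<not> height d q < height d (next_point S p)"
    using assms(5) unfolding height_less_iff[OF assms(1) in_d(2,3)] height_less_iff[OF assms(1) in_d(1,2)]
    using Max_ge[OF S assms(4)] next_seat_le[OF S assms(4), of "fst p"] next_seat_Max_le[OF S assms(4)]
    by (auto simp: next_point_def)
  then show ?thesis by simp
qed

text \<open>At most one of the two points wraps, as their seats differ. If one does, the change of
  its \<open>snd\<close> is offset by the reversed seat comparison; if none does,
  \<open>next_seat\<close> keeps the order of the seats.\<close>

lemma floor_height_diff_next_point:
  assumes "d \<ge> 1" "S \<subseteq> {1..d}" "fst p \<in> S" "fst q \<in> S" "fst p \<noteq> fst q"
  shows "\<lfloor>height d (next_point S q) - height d (next_point S p)\<rfloor> = \<lfloor>height d q - height d p\<rfloor>"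
proof -
  have S: "finite S" using assms(2) finite_subset by blast
  have in_d: "fst p \<in> {1..d}" "fst q \<in> {1..d}" "fst (next_point S p) \<in> {1..d}" 
    "fst (next_point S q) \<in> {1..d}"
    using assms next_seat_in_range[OF assms(2)] by (auto simp: next_point_def simp del: atLeastAtMost_iff)
  have less: "next_seat S i < next_seat S k" if "i \<in> S" "k \<in> S" "i < k" "k \<noteq> Max S" for i k
    using next_seat_le[OF S that(2,3)] next_seat_greater[OF S that(2,4)] by simp
  have Max: "next_seat S (Max S) < next_seat S i" if "i \<in> S" "i \<noteq> Max S" for i
    using next_seat_Max_le[OF S that(1)] next_seat_greater[OF S that] by simp
  have le_Max: "fst p \<le> Max S" "fst q \<le> Max S"
    using Max_ge[OF S] assms(3,4) by auto
  have "int (snd (next_point S q)) - int (snd (next_point S p))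
      - of_bool (fst (next_point S q) < fst (next_point S p)) =
    int (snd q) - int (snd p) - of_bool (fst q < fst p)"
  proof (cases "fst p = Max S")
    case True
    moreover have "next_seat S (Max S) < next_seat S (fst q)"
      using Max[OF assms(4)] assms(5) True by simp
    ultimately show ?thesis
      using le_Max assms(5) by (simp add: next_point_def)
  next
    case p: False
    show ?thesis
    proof (cases "fst q = Max S")
      case True
      moreover have "next_seat S (Max S) < next_seat S (fst p)"
        using Max[OF assms(3) p] .
      ultimately show ?thesis
        using le_Max p by (simp add: next_point_def)
    next
      case q: False
      have "next_seat S (fst q) < next_seat S (fst p) \<longleftrightarrow> fst q < fst p"
        using less[OF assms(3,4) _ q] less[OF assms(4,3) _ p] assms(5)
        by (meson linorder_neqE_nat order_less_asym)
      then show ?thesis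
        using p q by (simp add: next_point_def)
    qed
  qed
  then show ?thesis
    unfolding floor_height_diff[OF assms(1) in_d(1,2)] floor_height_diff[OF assms(1) in_d(3,4)] .
qed

text \<open>Links the search for the smallest shift in \<open>step\<close> to the explicit cyclic
  successor, on which all later arguments rest.\<close>

lemma shift_Least:
  assumes "d \<ge> 1" "S \<subseteq> {1..d}" "fst p \<in> S"
  shows "shift d p (LEAST s. s > 0 \<and> seat (shift d p s) \<in> S) = next_point S p"
proof -
  define q where "q = next_point S p"
  \<comment> \<open>This is \<open>d\<close> times the height gap; the truncated subtraction is
    exact by \<open>lt\<close> below.\<close>
  define s where "s = d * snd q + fst q - (d * snd p + fst p)"
  have S: "finite S" using assms(2) finite_subset by blast
  have q: "fst q \<in> S" "fst q \<in> {1..d}" and p: "fst p \<in> {1..d}"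
    using assms next_seat_in[OF S] next_seat_in_range[OF assms(2)]
    by (auto simp: q_def next_point_def simp del: atLeastAtMost_iff)
  have less: "height d p < height d q"
    unfolding q_def by (rule height_next_point[OF assms])
  have height: "height d p = real (d * snd p + fst p) / real d" for p
    using assms(1) by (simp add: height_def field_simps)
  from less have "real (d * snd p + fst p) < real (d * snd q + fst q)"
    using assms(1) by (simp add: height divide_less_cancel del: of_nat_add of_nat_mult)
  then have lt: "d * snd p + fst p < d * snd q + fst q"
    by (simp only: of_nat_less_iff)
  then have s0: "s > 0" by (simp add: s_def)
  have "real (d * snd q + fst q) = real (d * snd p + fst p) + real s"
    using lt unfolding s_def by linarith
  then have hq: "height d q = height d p + real s / real d"
    by (simp only: height add_divide_distrib)
  have shift: "seat (shift d p t) \<in> {1..d}" "height d (shift d p t) = height d p + real t / real d" for t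
    using shift_props[OF assms(1), of p t] p by (auto simp: seat_def)
  have eq: "shift d p s = q"
    by (rule height_inj[OF assms(1)]) (use shift hq q in \<open>auto simp: seat_def\<close>)
  have "(LEAST s. s > 0 \<and> seat (shift d p s) \<in> S) = s"
  proof (rule Least_equality)
    fix t assume t: "t > 0 \<and> seat (shift d p t) \<in> S"
    then have "height d p < height d (shift d p t)"
      using assms(1) by (simp add: shift)
    from next_point_least[OF assms(1-3) _ this] t have "height d q \<le> height d (shift d p t)"
      by (simp add: q_def seat_def)
    then show "s \<le> t"
      using assms(1) by (simp add: hq shift divide_le_cancel)
  qed (use s0 eq q in \<open>simp add: seat_def\<close>)
  with eq show ?thesis by (simp add: q_def)
qed

section \<open>The sorted points of a tuple\<close>

lemma finite_points: "finite (points d x)"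
  unfolding points_def by (rule finite_image_set) simp

lemma card_points: "card (points d x) = d"
proof -
  have "points d x = (\<lambda>i. (i, x i)) ` {1..d}"
    by (auto simp: points_def)
  then show ?thesis
    by (simp add: card_image inj_on_def)
qed

lemma inj_on_height_points: "d \<ge> 1 \<Longrightarrow> inj_on (height d) (points d x)"
  by (rule inj_onI, rule height_inj) (auto simp: points_def seat_def)

lemma
  assumes "d \<ge> 1"
  shows delta_image: "delta d x ` {1..d} = points d x"
    and delta_mono: "1 \<le> i \<Longrightarrow> i < k \<Longrightarrow> k \<le> d \<Longrightarrow> height d (delta d x i) < height d (delta d x k)"
proof -
  define l where "l = sorted_key_list_of_set (height d) (points d x)"
  have l: "sorted_wrt (<) (map (height d) l)" "set l = points d x" "length l = d"
    using sorted_key_list_of_set_eq_iff[OF inj_on_height_points[OF assms] finite_points, of x l]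
    by (simp_all add: card_points l_def)
  have del: "delta d x k = l ! (k - 1)" for k
    by (simp add: delta_def l_def)
  have "{1..d} = Suc ` {0..<d}"
    by (simp add: image_Suc_atLeastLessThan atLeastLessThanSuc_atLeastAtMost)
  then have "delta d x ` {1..d} = (!) l ` {0..<d}"
    by (simp only: image_image del diff_Suc_1)
  also have "\<dots> = points d x"
    using l by (metis image_set map_nth set_upt)
  finally show "delta d x ` {1..d} = points d x" .
  show "height d (delta d x i) < height d (delta d x k)" if "1 \<le> i" "i < k" "k \<le> d"
    using sorted_wrt_nth_less[OF l(1), of "i - 1" "k - 1"] that l(3) by (simp add: del)
qed

text \<open>A finite set has only one increasing enumeration.\<close>

lemma delta_eqI:
  assumes "d \<ge> 1" "f ` {1..d} = points d x"
    and mono: "\<And>i k. 1 \<le> i \<Longrightarrow> i < k \<Longrightarrow> k \<le> d \<Longrightarrow> height d (f i) < height d (f k)"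
    and "k \<in> {1..d}"
  shows "delta d x k = f k"
proof -
  define l where "l = map f [1..<d + 1]"
  have "sorted_wrt (<) (map (height d) l)"
    by (auto simp: l_def sorted_wrt_iff_nth_less intro!: mono simp del: upt_Suc)
  moreover have "set l = points d x"
    using assms(2) by (simp add: l_def atLeastLessThanSuc_atLeastAtMost del: upt_Suc)
  ultimately have "sorted_key_list_of_set (height d) (points d x) = l"
    using sorted_key_list_of_set_eq_iff[OF inj_on_height_points[OF assms(1)] finite_points, of x l]
    by (simp add: card_points l_def)
  moreover have "l ! (k - 1) = f k"
    using assms(4) nth_map[of "k - 1" "[1..<d + 1]" f] nth_upt[of 1 "k - 1" "d + 1"]
    by (auto simp: l_def simp del: upt_Suc)
  ultimately show ?thesis
    by (simp add: delta_def)
qed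

lemma delta_in_points:
  assumes "d \<ge> 1" "k \<in> {1..d}"
  shows "fst (delta d x k) \<in> {1..d} \<and> snd (delta d x k) = x (fst (delta d x k))"
proof -
  have "delta d x k \<in> points d x"
    using delta_image[OF assms(1)] assms(2) by blast
  then show ?thesis by (auto simp: points_def)
qed

lemma bij_betw_seat_delta:
  assumes "d \<ge> 1" shows "bij_betw (\<lambda>k. fst (delta d x k)) {1..d} {1..d}"
proof -
  have "(\<lambda>k. fst (delta d x k)) ` {1..d} = fst ` points d x"
    using delta_image[OF assms, of x] by (metis image_image)
  also have "\<dots> = {1..d}"
    by (force simp: points_def)
  finally show ?thesis
    by (simp add: bij_betw_def eq_card_imp_inj_on)
qed

text \<open>The sorted points recover the graph on \<open>{1..d}\<close>, and outside it both tuples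
  are \<open>0\<close>. This gives the uniqueness behind the \<open>THE\<close> in
  \<open>g\<close>.\<close>

lemma tuples_eqI:
  assumes "d \<ge> 1" "x \<in> tuples d" "y \<in> tuples d" "\<And>k. k \<in> {1..d} \<Longrightarrow> delta d x k = delta d y k"
  shows "x = y"
proof -
  have "points d x = points d y"
    unfolding delta_image[OF assms(1), symmetric] using assms(4) by (rule image_cong[OF refl])
  then have "x i = y i" if "i \<in> {1..d}" for i
    using that by (fastforce simp: points_def set_eq_iff)
  then show ?thesis
    using assms(2,3) by (intro ext) (metis (mono_tags, lifting) mem_Collect_eq tuples_def)
qed

text \<open>Points with distinct seats form the graph of a tuple. This gives the existence behind
  the \<open>THE\<close> in \<open>g\<close>.\<close>

lemma ex_tuple_delta:
  assumes "d \<ge> 1" "bij_betw (\<lambda>k. fst (f k)) {1..d} {1..d}"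
    and mono: "\<And>i k. 1 \<le> i \<Longrightarrow> i < k \<Longrightarrow> k \<le> d \<Longrightarrow> height d (f i) < height d (f k)"
  shows "\<exists>x \<in> tuples d. \<forall>k \<in> {1..d}. delta d x k = f k"
proof -
  \<comment> \<open>The inverse finds the index of the point in seat \<open>i\<close>; the default
    \<open>0\<close> puts \<open>x\<close> into \<open>tuples d\<close>.\<close>
  define x where "x i = (if i \<in> {1..d} then snd (f (inv_into {1..d} (\<lambda>k. fst (f k)) i)) else 0)" for i
  have f: "f k = (fst (f k), x (fst (f k)))" if "k \<in> {1..d}" for k
    using inv_into_f_f[OF bij_betw_imp_inj_on[OF assms(2)] that] bij_betwE[OF assms(2)] that
    by (simp add: x_def prod_eq_iff)
  have "f ` {1..d} = (\<lambda>i. (i, x i)) ` (\<lambda>k. fst (f k)) ` {1..d}"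
    unfolding image_image by (rule image_cong[OF refl f])
  also have "\<dots> = points d x"
    unfolding bij_betw_imp_surj_on[OF assms(2)] by (auto simp: points_def)
  finally have image: "f ` {1..d} = points d x" .
  have "delta d x k = f k" if "k \<in> {1..d}" for k
    by (rule delta_eqI[OF assms(1) image mono that])
  moreover have "x \<in> tuples d"
    by (auto simp: tuples_def x_def)
  ultimately show ?thesis by blast
qed

section \<open>The operators\<close>

definition seats_from :: "nat \<Rightarrow> nat \<Rightarrow> (nat \<Rightarrow> nat) \<Rightarrow> nat set" where
  "seats_from d j x = (\<lambda>k. fst (delta d x k)) ` {j..d}"

lemma seats_from_subset: "d \<ge> 1 \<Longrightarrow> j \<ge> 1 \<Longrightarrow> seats_from d j x \<subseteq> {1..d}"
  using delta_in_points[of d] by (fastforce simp: seats_from_def)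

lemma bij_betw_seats_from:
  assumes "d \<ge> 1" "j \<ge> 1"
  shows "bij_betw (\<lambda>k. fst (delta d x k)) {j..d} (seats_from d j x)"
  using bij_betw_subset[OF bij_betw_seat_delta[OF assms(1)], of "{j..d}"] assms(2)
  by (auto simp: seats_from_def)

text \<open>All seats together fill \<open>{1..d}\<close>, so the moved seats are the complement of
  the seats of the points below \<open>j\<close>. Since \<open>g d j\<close> fixes those points, its
  output determines the moved seats.\<close>

lemma seats_from_eq:
  assumes "d \<ge> 1" "j \<ge> 1" "\<And>k. k \<in> {1..<j} \<Longrightarrow> delta d x k = delta d y k" "j \<le> d"
  shows "seats_from d j x = seats_from d j y"
proof -
  have "seats_from d j z = {1..d} - (\<lambda>k. fst (delta d z k)) ` {1..<j}" for z
  proof -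
    have "{j..d} = {1..d} - {1..<j}" "{1..<j} \<subseteq> {1..d}"
      using assms(2,4) by auto
    moreover have "(\<lambda>k. fst (delta d z k)) ` ({1..d} - {1..<j}) =
        (\<lambda>k. fst (delta d z k)) ` {1..d} - (\<lambda>k. fst (delta d z k)) ` {1..<j}"
      using bij_betw_imp_inj_on[OF bij_betw_seat_delta[OF assms(1), of z]] calculation
      by (intro inj_on_image_set_diff) auto
    ultimately show ?thesis
      using bij_betw_imp_surj_on[OF bij_betw_seat_delta[OF assms(1), of z]]
      by (simp only: seats_from_def)
  qed
  moreover have "(\<lambda>k. fst (delta d x k)) ` {1..<j} = (\<lambda>k. fst (delta d y k)) ` {1..<j}"
    using assms(3) by (intro image_cong) auto
  ultimately show ?thesis by simp
qed

text \<open>The moved configuration has permuted seats and is still increasing, so exactly one tuple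
  realises it and the \<open>THE\<close> in \<open>g\<close> is meaningful.\<close>

lemma
  assumes "d \<ge> 1" "j \<in> {1..d}"
  shows g_tuples: "g d j x \<in> tuples d"
    and delta_g: "k \<in> {1..d} \<Longrightarrow> delta d (g d j x) k =
      (if k < j then delta d x k else next_point (seats_from d j x) (delta d x k))"
proof -
  define S where "S = seats_from d j x"
  define f where "f k = (if k < j then delta d x k else next_point S (delta d x k))" for k
  have j: "j \<ge> 1" "j \<le> d" using assms(2) by auto
  have S: "S \<subseteq> {1..d}" "finite S"
    unfolding S_def using seats_from_subset[OF assms(1) j(1), of x] finite_subset by blast+
  have inS: "fst (delta d x k) \<in> S" if "k \<in> {j..d}" for k
    using that by (simp add: S_def seats_from_def)
  have shift: "shift d (delta d x k) (step d j x k) = next_point S (delta d x k)" if "k \<in> {j..d}" for k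
  proof -
    have "{seat (delta d x l) | l. l \<in> {j..d}} = S"
      by (auto simp: S_def seats_from_def seat_def)
    then show ?thesis
      unfolding step_def using shift_Least[OF assms(1) S(1) inS[OF that]] by simp
  qed
  have bij: "bij_betw (\<lambda>k. fst (f k)) {1..d} {1..d}"
  proof -
    have "bij_betw (\<lambda>k. fst (f k)) {j..d} S"
    proof -
      have "bij_betw (next_seat S \<circ> (\<lambda>k. fst (delta d x k))) {j..d} S"
        unfolding S_def
        by (rule bij_betw_trans[OF bij_betw_seats_from[OF assms(1) j(1)] bij_betw_next_seat])
          (use S in \<open>simp add: S_def\<close>)
      then show ?thesis
        by (rule bij_betw_cong[THEN iffD1, rotated]) (simp add: f_def next_point_def)
    qed
    moreover have "bij_betw (\<lambda>k. fst (f k)) {1..<j} ((\<lambda>k. fst (delta d x k)) ` {1..<j})"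
    proof -
      have "bij_betw (\<lambda>k. fst (delta d x k)) {1..<j} ((\<lambda>k. fst (delta d x k)) ` {1..<j})"
        using bij_betw_seat_delta[OF assms(1), of x] j
        by (auto simp: bij_betw_def intro: inj_on_subset)
      then show ?thesis
        by (rule bij_betw_cong[THEN iffD1, rotated]) (simp add: f_def)
    qed
    moreover have "S \<inter> (\<lambda>k. fst (delta d x k)) ` {1..<j} = {}"
      unfolding S_def seats_from_def
      using bij_betw_seat_delta[OF assms(1), of x] j
      by (subst inj_on_image_Int[symmetric, of _ "{1..d}"]) (auto simp: bij_betw_def)
    ultimately have "bij_betw (\<lambda>k. fst (f k)) ({j..d} \<union> {1..<j})
        (S \<union> (\<lambda>k. fst (delta d x k)) ` {1..<j})"
      by (rule bij_betw_combine)
    moreover have "{j..d} \<union> {1..<j} = {1..d}" using j by auto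
    moreover have "S \<union> (\<lambda>k. fst (delta d x k)) ` {1..<j} = (\<lambda>k. fst (delta d x k)) ` ({j..d} \<union> {1..<j})"
      by (simp add: S_def seats_from_def image_Un)
    ultimately show ?thesis
      using bij_betw_seat_delta[OF assms(1), of x] by (simp add: bij_betw_def)
  qed
  have mono: "height d (f i) < height d (f k)" if "1 \<le> i" "i < k" "k \<le> d" for i k
  proof -
    have less: "height d (delta d x i) < height d (delta d x k)"
      by (rule delta_mono[OF assms(1) that])
    show ?thesis
    proof (cases "k < j")
      case True
      with less that show ?thesis by (simp add: f_def)
    next
      case False
      then have k: "height d (delta d x k) < height d (f k)"
        using height_next_point[OF assms(1) S(1) inS] that by (simp add: f_def)
      show ?thesis
      proof (cases "i < j")
        case True
        with less k show ?thesis by (simp add: f_def)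
      next
        case False
        \<comment> \<open>Both points move. The old position of the upper one lies over
          \<open>S\<close> above the lower one, so the lower one stops there at the latest.\<close>
        then have "height d (f i) \<le> height d (delta d x k)"
          using next_point_least[OF assms(1) S(1) inS inS less] that by (simp add: f_def)
        with k show ?thesis by simp
      qed
    qed
  qed
  obtain y where y: "y \<in> tuples d" "\<forall>k \<in> {1..d}. delta d y k = f k"
    using ex_tuple_delta[OF assms(1) bij mono] by blast
  \<comment> \<open>The predicate under the \<open>THE\<close> in \<open>g\<close>, named so that
    \<open>theI\<close> applies to it.\<close>
  define Q where "Q z \<longleftrightarrow> z \<in> tuples d \<and> (\<forall>k \<in> {1..d}. delta d z k =
      (if k < j then delta d x k else shift d (delta d x k) (step d j x k)))" for z
  have Q: "Q z \<longleftrightarrow> z \<in> tuples d \<and> (\<forall>k \<in> {1..d}. delta d z k = f k)" for z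
    using shift by (auto simp: Q_def f_def)
  have "Q (THE z. Q z)"
  proof (rule theI[of Q y])
    show "Q y" using y by (simp add: Q)
    show "z = y" if "Q z" for z
      using that y by (intro tuples_eqI[OF assms(1)]) (auto simp: Q)
  qed
  then have "Q (g d j x)"
    by (simp add: g_def Q_def[abs_def])
  then show "g d j x \<in> tuples d"
    and "k \<in> {1..d} \<Longrightarrow> delta d (g d j x) k =
      (if k < j then delta d x k else next_point (seats_from d j x) (delta d x k))"
    by (auto simp: Q f_def S_def)
qed

text \<open>The fixed points can be read off the image and determine the moved seats; on these
  \<open>next_point\<close> is injective.\<close>

lemma inj_on_g:
  assumes "d \<ge> 1" "j \<in> {1..d}"
  shows "inj_on (g d j) (tuples d)"
proof (rule inj_onI)
  fix x y assume xy: "x \<in> tuples d" "y \<in> tuples d" and eq: "g d j x = g d j y"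
  have j: "j \<ge> 1" "j \<le> d" using assms(2) by auto
  note del = delta_g[OF assms]
  have low: "delta d x k = delta d y k" if "k \<in> {1..<j}" for k
    using del[of k x] del[of k y] that j by (simp add: eq)
  have S: "seats_from d j x = seats_from d j y"
    by (rule seats_from_eq[OF assms(1) j(1) low j(2)])
  have fin: "finite (seats_from d j y)"
    by (simp add: seats_from_def)
  have "delta d x k = delta d y k" if "k \<in> {j..d}" for k
  proof -
    have "next_point (seats_from d j y) (delta d x k) = next_point (seats_from d j y) (delta d y k)"
      using del[of k x] del[of k y] that j by (simp add: eq S)
    moreover have "delta d x k \<in> seats_from d j y \<times> UNIV"
      using that unfolding S[symmetric] by (auto simp: seats_from_def mem_Times_iff)
    moreover have "delta d y k \<in> seats_from d j y \<times> UNIV"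
      using that by (auto simp: seats_from_def mem_Times_iff)
    ultimately show ?thesis
      by (rule inj_onD[OF inj_on_next_point[OF fin]])
  qed
  with low show "x = y"
    using tuples_eqI[OF assms(1) xy] by (metis atLeastAtMost_iff atLeastLessThan_iff not_less)
qed

section \<open>Effect of a single operator on \<open>total\<close> and \<open>W\<close>\<close>

lemma total_conv_delta: "d \<ge> 1 \<Longrightarrow> total d x = (\<Sum>k = 1..d. snd (delta d x k))"
  unfolding total_def sum.reindex_bij_betw[OF bij_betw_seat_delta, symmetric, of d x x]
  using delta_in_points by (intro sum.cong) auto

text \<open>Exactly one moved point sits in the largest seat, and only this one gains a
  unit.\<close>

lemma sum_snd_next_point:
  assumes "d \<ge> 1" "j \<in> {1..d}"
  shows "(\<Sum>k = j..d. snd (next_point (seats_from d j x) (delta d x k))) =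
    (\<Sum>k = j..d. snd (delta d x k)) + 1"
proof -
  define S where "S = seats_from d j x"
  have bij: "bij_betw (\<lambda>k. fst (delta d x k)) {j..d} S"
    unfolding S_def using assms by (intro bij_betw_seats_from) auto
  have "finite S" "S \<noteq> {}"
    using assms by (auto simp: S_def seats_from_def)
  then have "Max S \<in> S" by simp
  then have "Max S \<in> (\<lambda>k. fst (delta d x k)) ` {j..d}"
    unfolding bij_betw_imp_surj_on[OF bij] .
  then obtain k where k: "k \<in> {j..d}" "fst (delta d x k) = Max S"
    by (elim imageE) (rule that, simp_all)
  have "i = k" if "i \<in> {j..d}" "fst (delta d x i) = Max S" for i
    by (rule inj_onD[OF bij_betw_imp_inj_on[OF bij]]) (use that k in simp_all)
  with k have "{j..d} \<inter> {k. fst (delta d x k) = Max S} = {k}"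
    by blast
  then have "(\<Sum>k = j..d. of_bool (fst (delta d x k) = Max S)) = (1::nat)"
    by (simp add: sum_of_bool_eq)
  then show ?thesis
    by (simp only: next_point_def S_def snd_conv sum.distrib)
qed

lemma sum_split_at:
  fixes f :: "nat \<Rightarrow> 'a::comm_monoid_add"
  assumes "j \<in> {1..d}"
  shows "(\<Sum>k = 1..d. f k) = (\<Sum>k = 1..<j. f k) + (\<Sum>k = j..d. f k)"
proof -
  have "{1..d} = {1..<j} \<union> {j..d}" using assms by auto
  moreover have "{1..<j} \<inter> {j..d} = {}" by auto
  ultimately show ?thesis by (simp only: sum.union_disjoint finite_atLeastAtMost finite_atLeastLessThan)
qed

lemma total_g:
  assumes "d \<ge> 1" "j \<in> {1..d}"
  shows "total d (g d j x) = total d x + 1"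
proof -
  have "total d (g d j x) = (\<Sum>k = 1..<j. snd (delta d x k)) +
      (\<Sum>k = j..d. snd (next_point (seats_from d j x) (delta d x k)))"
    unfolding total_conv_delta[OF assms(1)] sum_split_at[OF assms(2)]
    using assms(2) delta_g[OF assms, of _ x] by (intro arg_cong2[of _ _ _ _ "(+)"] sum.cong) auto
  then show ?thesis
    unfolding sum_snd_next_point[OF assms] total_conv_delta[OF assms(1), of x] sum_split_at[OF assms(2)]
    by simp
qed

lemma W_conv_int:
  assumes "d \<ge> 1"
  shows "int (W d x) = (\<Sum>(i, k) \<in> {(i, k). 1 \<le> i \<and> i < k \<and> k \<le> d}.
    \<lfloor>height d (delta d x k) - height d (delta d x i)\<rfloor>)"
  unfolding W_def of_nat_sum
  using delta_mono[OF assms, of _ _ x] by (intro sum.cong) (auto simp: less_imp_le)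

text \<open>By \<open>floor_height_diff\<close> the sum splits into the \<open>snd\<close>
  components, which gain one unit in total, and the number of moved seats below that of the fixed
  point, which stays the same.\<close>

lemma sum_floor_next_point:
  assumes "d \<ge> 1" "j \<in> {1..d}" "i \<in> {1..<j}"
  shows "(\<Sum>k = j..d. \<lfloor>height d (next_point (seats_from d j x) (delta d x k)) - height d (delta d x i)\<rfloor>) =
    (\<Sum>k = j..d. \<lfloor>height d (delta d x k) - height d (delta d x i)\<rfloor>) + 1"
proof -
  define S where "S = seats_from d j x"
  define c where "c = delta d x i"
  have S: "S \<subseteq> {1..d}" "finite S"
    unfolding S_def using seats_from_subset[OF assms(1), of j x] assms(2) finite_subset by auto
  have bij: "bij_betw (\<lambda>k. fst (delta d x k)) {j..d} S"
    unfolding S_def using assms by (intro bij_betw_seats_from) auto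
  have inS: "fst (delta d x k) \<in> S" if "k \<in> {j..d}" for k
    using that by (simp add: S_def seats_from_def)
  have c: "fst c \<in> {1..d}"
    using assms delta_in_points[of d i x] by (simp add: c_def)
  have n: "(\<Sum>k = j..d. int (snd (next_point S (delta d x k)))) = (\<Sum>k = j..d. int (snd (delta d x k))) + 1"
    unfolding of_nat_sum[symmetric] S_def sum_snd_next_point[OF assms(1,2)] by simp
  \<comment> \<open>The count depends only on the set of moved seats, and \<open>next_seat\<close>
    permutes that set.\<close>
  have "(\<Sum>k = j..d. of_bool (next_seat S (fst (delta d x k)) < fst c)) =
        (\<Sum>s\<in>S. of_bool (next_seat S s < fst c) :: int)"
    by (rule sum.reindex_bij_betw[OF bij])
  also have "\<dots> = (\<Sum>s\<in>S. of_bool (s < fst c))"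
    by (rule sum.reindex_bij_betw[OF bij_betw_next_seat[OF S(2)]])
  also have "\<dots> = (\<Sum>k = j..d. of_bool (fst (delta d x k) < fst c))"
    by (rule sum.reindex_bij_betw[OF bij, symmetric])
  finally have b: "(\<Sum>k = j..d. of_bool (fst (next_point S (delta d x k)) < fst c)) =
      (\<Sum>k = j..d. of_bool (fst (delta d x k) < fst c) :: int)"
    by (simp add: next_point_def)
  have "(\<Sum>k = j..d. \<lfloor>height d (next_point S (delta d x k)) - height d c\<rfloor>) =
    (\<Sum>k = j..d. int (snd (next_point S (delta d x k))) - int (snd c)
        - of_bool (fst (next_point S (delta d x k)) < fst c))"
    using S inS next_seat_in_range[OF S(1) inS]
    by (intro sum.cong refl floor_height_diff[OF assms(1) c])
      (auto simp: next_point_def simp del: atLeastAtMost_iff)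
  also have "\<dots> = (\<Sum>k = j..d. int (snd (delta d x k)) - int (snd c) - of_bool (fst (delta d x k) < fst c)) + 1"
    unfolding sum_subtractf n b by simp
  also have "(\<Sum>k = j..d. int (snd (delta d x k)) - int (snd c) - of_bool (fst (delta d x k) < fst c)) =
    (\<Sum>k = j..d. \<lfloor>height d (delta d x k) - height d c\<rfloor>)"
    using S inS
    by (intro sum.cong refl floor_height_diff[OF assms(1) c, symmetric])
      (auto simp del: atLeastAtMost_iff)
  finally show ?thesis by (simp add: S_def c_def)
qed

text \<open>Pairs of two fixed or two moved points keep their floors. The mixed pairs form the
  rectangle \<open>{1..<j} \<times> {j..d}\<close>, each row of which gains 1.\<close>

lemma W_g:
  assumes "d \<ge> 1" "j \<in> {1..d}"
  shows "W d (g d j x) = W d x + (j - 1)"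
proof -
  define P where "P = {(i, k). 1 \<le> i \<and> i < k \<and> k \<le> d}"
  define F where "F y = (\<lambda>(i, k). \<lfloor>height d (delta d y k) - height d (delta d y i)\<rfloor>)" for y
  define S where "S = seats_from d j x"
  have j: "j \<ge> 1" "j \<le> d" using assms(2) by auto
  have S: "S \<subseteq> {1..d}"
    unfolding S_def using seats_from_subset[OF assms(1) j(1)] by auto
  have fin: "finite P"
    by (rule finite_subset[of _ "{..d} \<times> {..d}"]) (auto simp: P_def)
  have sub: "{1..<j} \<times> {j..d} \<subseteq> P" using j by (auto simp: P_def)
  have same: "F (g d j x) p = F x p" if "p \<in> P - {1..<j} \<times> {j..d}" for p
  proof -
    obtain i k where p: "p = (i, k)" by (cases p)
    with that have ik: "1 \<le> i" "i < k" "k \<le> d" "\<not> (i < j \<and> j \<le> k)" by (auto simp: P_def)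
    show ?thesis
    proof (cases "k < j")
      case True
      with ik j show ?thesis by (simp add: F_def p delta_g[OF assms])
    next
      case False
      with ik have "i \<ge> j" by auto
      with ik have mem: "fst (delta d x i) \<in> S" "fst (delta d x k) \<in> S"
        by (auto simp: S_def seats_from_def)
      have "fst (delta d x i) \<noteq> fst (delta d x k)"
        using inj_on_eq_iff[OF bij_betw_imp_inj_on[OF bij_betw_seat_delta[OF assms(1)]], of i k x] ik by auto
      with floor_height_diff_next_point[OF assms(1) S mem this] ik False \<open>i \<ge> j\<close> show ?thesis
        by (simp add: F_def p delta_g[OF assms] S_def)
    qed
  qed
  have "(\<Sum>p\<in>{1..<j} \<times> {j..d}. F (g d j x) p) =
      (\<Sum>i = 1..<j. \<Sum>k = j..d. \<lfloor>height d (next_point S (delta d x k)) - height d (delta d x i)\<rfloor>)"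
    unfolding sum.cartesian_product using j by (intro sum.cong) (auto simp: F_def delta_g[OF assms] S_def)
  also have "\<dots> = (\<Sum>i = 1..<j. (\<Sum>k = j..d. \<lfloor>height d (delta d x k) - height d (delta d x i)\<rfloor>) + 1)"
    unfolding S_def by (intro sum.cong refl sum_floor_next_point[OF assms])
  also have "\<dots> = (\<Sum>p\<in>{1..<j} \<times> {j..d}. F x p) + int (j - 1)"
    unfolding F_def sum.cartesian_product[symmetric] sum.distrib by simp
  finally have cross: "(\<Sum>p\<in>{1..<j} \<times> {j..d}. F (g d j x) p) =
      (\<Sum>p\<in>{1..<j} \<times> {j..d}. F x p) + int (j - 1)" .
  have "(\<Sum>p\<in>P - {1..<j} \<times> {j..d}. F (g d j x) p) = (\<Sum>p\<in>P - {1..<j} \<times> {j..d}. F x p)"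
    by (rule sum.cong[OF refl same])
  with cross have "(\<Sum>p\<in>P. F (g d j x) p) = (\<Sum>p\<in>P. F x p) + int (j - 1)"
    unfolding sum.subset_diff[OF sub fin] by simp
  then have "int (W d (g d j x)) = int (W d x + (j - 1))"
    unfolding W_conv_int[OF assms(1)] of_nat_add P_def F_def by simp
  then show ?thesis by (simp only: of_nat_eq_iff)
qed

section \<open>Contents\<close>

lemma tq_monom_0: "tq_monom 0 0 = 1"
  by (simp add: tq_monom_def)

lemma tq_monom_mult: "tq_monom m n * tq_monom m' n' = tq_monom (m + m') (n + n')"
  by (simp add: tq_monom_def power_add fps_const_mult[symmetric] mult_ac del: fps_const_mult)

lemma tq_monom_power: "tq_monom m n ^ k = tq_monom (k * m) (k * n)"
  by (induction k) (simp_all add: tq_monom_0 tq_monom_mult)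

lemma tq_monom_prod: "(\<Prod>i\<in>I. tq_monom (m i) (n i)) = tq_monom (sum m I) (sum n I)"
  by (induction I rule: infinite_finite_induct) (simp_all add: tq_monom_0 tq_monom_mult)

lemma cont_g:
  assumes "d \<ge> 1" "j \<in> {1..d}"
  shows "cont d (g d j x) = tq_monom 1 (j - 1) * cont d x"
  by (simp add: cont_def tq_monom_mult total_g[OF assms] W_g[OF assms] add.commute)

section \<open>The action\<close>

lemma g_funpow_tuples:
  assumes "d \<ge> 1" "j \<in> {1..d}" "x \<in> tuples d"
  shows "(g d j ^^ n) x \<in> tuples d"
  using assms(3) by (cases n) (simp_all add: g_tuples[OF assms(1,2)])

lemma cont_g_funpow:
  assumes "d \<ge> 1" "j \<in> {1..d}"
  shows "cont d ((g d j ^^ n) x) = tq_monom n ((j - 1) * n) * cont d x"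
  by (induction n)
    (simp_all add: tq_monom_0 cont_g[OF assms] mult.assoc[symmetric] tq_monom_mult)

lemma delta_g_funpow:
  assumes "d \<ge> 1" "j \<in> {1..d}" "k \<in> {1..<j}"
  shows "delta d ((g d j ^^ n) x) k = delta d x k"
  using assms(2,3) by (induction n) (simp_all add: delta_g[OF assms(1,2)])

lemma height_delta_g_funpow:
  assumes "d \<ge> 1" "j \<in> {1..d}" "n > 0"
  shows "height d (delta d x j) < height d (delta d ((g d j ^^ n) x) j)"
proof -
  have less: "height d (delta d y j) < height d (delta d (g d j y) j)" for y
  proof -
    have "height d (delta d y j) < height d (next_point (seats_from d j y) (delta d y j))"
      using assms(2)
      by (intro height_next_point[OF assms(1)] seats_from_subset[OF assms(1)])
        (auto simp: seats_from_def)
    then show ?thesis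
      using assms(2) by (simp add: delta_g[OF assms(1,2)])
  qed
  show ?thesis
    using assms(3)
  proof (induction n rule: nat_induct_non_zero)
    case (Suc n)
    then show ?case using less[of "(g d j ^^ n) x"] by simp
  qed (simp add: less)
qed

text \<open>Cancelling \<open>m\<close> applications by injectivity leaves
  \<open>y = (g d j ^^ (n - m)) z\<close>. A positive exponent would raise the point at index
  \<open>j\<close>, on which \<open>y\<close> and \<open>z\<close> agree.\<close>

lemma g_funpow_eq_le:
  assumes "d \<ge> 1" "j \<in> {1..d}" "y \<in> tuples d" "z \<in> tuples d" "delta d y j = delta d z j"
    and "(g d j ^^ m) y = (g d j ^^ n) z" "m \<le> n"
  shows "m = n \<and> y = z"
proof -
  have cancel: "u = w" if "u \<in> tuples d" "w \<in> tuples d" "(g d j ^^ m) u = (g d j ^^ m) w" for u w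
    using that(3)
  proof (induction m)
    case (Suc m)
    have "(g d j ^^ m) u = (g d j ^^ m) w"
      by (rule inj_onD[OF inj_on_g[OF assms(1,2)]])
        (use Suc.prems g_funpow_tuples[OF assms(1,2)] that in auto)
    then show ?case by (rule Suc.IH)
  qed simp
  have "(g d j ^^ m) y = (g d j ^^ m) ((g d j ^^ (n - m)) z)"
    unfolding assms(6) using funpow_add[of m "n - m" "g d j"] assms(7)
    by (simp add: o_def fun_eq_iff)
  then have y: "y = (g d j ^^ (n - m)) z"
    by (rule cancel[OF assms(3) g_funpow_tuples[OF assms(1,2,4)]])
  have "n - m = 0"
  proof (rule ccontr)
    assume "n - m \<noteq> 0"
    then have "height d (delta d z j) < height d (delta d y j)"
      unfolding y by (intro height_delta_g_funpow[OF assms(1,2)]) simp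
    with assms(5) show False by simp
  qed
  with y assms(7) show ?thesis by simp
qed

lemma g_funpow_eq:
  assumes "d \<ge> 1" "j \<in> {1..d}" "y \<in> tuples d" "z \<in> tuples d" "delta d y j = delta d z j"
    and "(g d j ^^ m) y = (g d j ^^ n) z"
  shows "m = n \<and> y = z"
  using g_funpow_eq_le[OF assms] g_funpow_eq_le[OF assms(1,2,4,3) assms(5,6)[symmetric]]
  by (cases "m \<le> n") auto

text \<open>Generalises \<open>g_pow\<close> to any list of indices, so that one can induct on the
  list.\<close>

definition g_comp :: "nat \<Rightarrow> (nat \<Rightarrow> nat) \<Rightarrow> nat list \<Rightarrow> (nat \<Rightarrow> nat) \<Rightarrow> (nat \<Rightarrow> nat)" where
  "g_comp d a js = foldr (\<lambda>j f. (g d j ^^ a j) \<circ> f) js id"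

lemma g_comp_Nil [simp]: "g_comp d a [] x = x"
  by (simp add: g_comp_def)

lemma g_comp_Cons [simp]: "g_comp d a (j # js) x = (g d j ^^ a j) (g_comp d a js x)"
  by (simp add: g_comp_def)

lemma g_pow_conv_g_comp: "g_pow d a = g_comp d a [1..<d + 1]"
  by (simp add: g_pow_def g_comp_def)

lemma g_comp_tuples:
  assumes "d \<ge> 1" "set js \<subseteq> {1..d}" "x \<in> tuples d"
  shows "g_comp d a js x \<in> tuples d"
  using assms(2) by (induction js) (auto intro!: g_funpow_tuples assms(1,3))

lemma delta_g_comp:
  assumes "d \<ge> 1" "set js \<subseteq> {1..d}" "k \<ge> 1" "\<And>j. j \<in> set js \<Longrightarrow> k < j"
  shows "delta d (g_comp d a js x) k = delta d x k"
  using assms(2,4)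
proof (induction js)
  case (Cons j js)
  have "delta d ((g d j ^^ a j) (g_comp d a js x)) k = delta d (g_comp d a js x) k"
    using Cons.prems assms(3) by (intro delta_g_funpow assms(1)) auto
  with Cons show ?case by simp
qed simp

lemma cont_g_comp:
  assumes "d \<ge> 1" "set js \<subseteq> {1..d}"
  shows "cont d (g_comp d a js x) =
    tq_monom (\<Sum>j\<leftarrow>js. a j) (\<Sum>j\<leftarrow>js. (j - 1) * a j) * cont d x"
  using assms(2)
  by (induction js)
    (simp_all add: tq_monom_0 cont_g_funpow[OF assms(1)] mult.assoc[symmetric] tq_monom_mult)

lemma cont_g_pow:
  assumes "d \<ge> 1"
  shows "cont d (g_pow d a x) = cont_\<Gamma> d a * cont d x"
proof -
  have "set [1..<d + 1] = {1..d}" by auto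
  then show ?thesis
    using cont_g_comp[OF assms, of "[1..<d + 1]" a x]
    by (simp add: g_pow_conv_g_comp cont_\<Gamma>_def interv_sum_list_conv_sum_set_nat del: upt_Suc)
qed

text \<open>The tail uses only indices above \<open>j\<close>, so both tail results share the point
  of \<open>x\<close> at index \<open>j\<close>. Then \<open>g_funpow_eq\<close> yields
  \<open>a j = b j\<close> and cancels this power.\<close>

lemma g_comp_inject:
  assumes "d \<ge> 1" "set js \<subseteq> {1..d}" "sorted_wrt (<) js" "x \<in> tuples d"
    and "g_comp d a js x = g_comp d b js x"
  shows "\<forall>j \<in> set js. a j = b j"
  using assms(2,3,5)
proof (induction js)
  case (Cons j js)
  have js: "set js \<subseteq> {1..d}" and j: "j \<in> {1..d}"
    using Cons.prems by auto
  have "delta d (g_comp d c js x) j = delta d x j" for c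
    using Cons.prems j by (intro delta_g_comp[OF assms(1) js]) auto
  then have "a j = b j \<and> g_comp d a js x = g_comp d b js x"
    using Cons.prems by (intro g_funpow_eq[OF assms(1) j] g_comp_tuples[OF assms(1) js assms(4)]) auto
  with Cons js show ?case by auto
qed simp

lemma inj_on_g_pow:
  assumes "d \<ge> 1" "x \<in> tuples d"
  shows "inj_on (\<lambda>a. g_pow d a x) (tuples d)"
proof (rule inj_onI)
  fix a b assume ab: "a \<in> tuples d" "b \<in> tuples d" "g_pow d a x = g_pow d b x"
  have set: "set [1..<d + 1] = {1..d}" by auto
  have "\<forall>j \<in> set [1..<d + 1]. a j = b j"
    by (rule g_comp_inject[OF assms(1) _ _ assms(2)])
      (use ab(3) set in \<open>simp_all add: g_pow_conv_g_comp del: upt_Suc\<close>)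
  with ab(1,2) show "a = b"
    unfolding set tuples_def by (intro ext) (metis (mono_tags, lifting) mem_Collect_eq)
qed

text \<open>Both exponents are linear in the tuple, so sums turn into products.\<close>

lemma cont_\<Gamma>_sum:
  "cont_\<Gamma> d (\<lambda>j. \<Sum>i = 1..r. c i * a i j) = (\<Prod>i = 1..r. cont_\<Gamma> d (a i) ^ c i)"
proof -
  have "(\<Sum>j = 1..d. \<Sum>i = 1..r. c i * a i j) = (\<Sum>i = 1..r. c i * (\<Sum>j = 1..d. a i j))"
    unfolding sum_distrib_left by (rule sum.swap)
  moreover have "(\<Sum>j = 1..d. (j - 1) * (\<Sum>i = 1..r. c i * a i j)) =
      (\<Sum>i = 1..r. c i * (\<Sum>j = 1..d. (j - 1) * a i j))"
    unfolding sum_distrib_left by (subst sum.swap) (simp add: mult_ac)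
  ultimately show ?thesis
    by (simp add: cont_\<Gamma>_def tq_monom_power tq_monom_prod)
qed

lemma fps_X_dvd_cont_\<Gamma>:
  assumes "a \<in> tuples d" "a \<noteq> (\<lambda>j. 0)"
  shows "fps_X dvd cont_\<Gamma> d a"
proof -
  obtain j where "a j \<noteq> 0"
    using assms(2) by (meson ext)
  moreover have "a j = 0" if "j \<notin> {1..d}"
    using assms(1) that by (simp add: tuples_def)
  ultimately have "j \<in> {1..d}" "a j \<noteq> 0"
    by metis+
  then have "0 < (\<Sum>j = 1..d. a j)"
    by (metis finite_atLeastAtMost sum_eq_0_iff neq0_conv)
  then show ?thesis
    unfolding cont_\<Gamma>_def tq_monom_def by (intro dvd_mult2 dvd_power disjI1)
qed

section \<open>Geometric series in several variables\<close>

text \<open>Convergence of formal power series means that each coefficient is eventually constant.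
  For \<open>int fps fps\<close> these are the coefficients in \<open>t\<close>.\<close>

lemma has_sum_fpsI:
  fixes f :: "'b \<Rightarrow> 'a::ab_group_add fps"
  assumes "\<And>n. \<exists>F. finite F \<and> F \<subseteq> A \<and>
    (\<forall>F'. finite F' \<longrightarrow> F \<subseteq> F' \<longrightarrow> F' \<subseteq> A \<longrightarrow> fps_nth (sum f F') n = fps_nth s n)"
  shows "(f has_sum s) A"
  unfolding has_sum_def tendsto_fps_iff eventually_finite_subsets_at_top
  using assms by meson

text \<open>Congruence modulo \<open>z\<close> is compatible with products.\<close>

lemma dvd_prod_diff:
  fixes f h :: "'b \<Rightarrow> 'a::comm_ring_1"
  assumes "\<And>i. i \<in> I \<Longrightarrow> z dvd f i - h i"
  shows "z dvd prod f I - prod h I"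
  using assms
proof (induction I rule: infinite_finite_induct)
  case (insert i I)
  have "prod f (insert i I) - prod h (insert i I) =
      (f i - h i) * prod f I + h i * (prod f I - prod h I)"
    using insert.hyps by (simp add: algebra_simps)
  also have "z dvd \<dots>"
    using insert by (intro dvd_add dvd_mult dvd_mult2) auto
  finally show ?case .
qed auto

lemma fps_X_power_dvd_nth:
  fixes z :: "'a::comm_ring_1 fps"
  assumes "fps_X ^ Suc n dvd z"
  shows "fps_nth z n = 0"
  using assms by (auto elim!: dvdE simp: fps_X_power_mult_nth simp del: power_Suc)

text \<open>With \<open>v\<close> the inverse of \<open>1 - u\<close>, the error of the truncated
  series is \<open>- (v * u ^ N)\<close>.\<close>

lemma fps_X_power_dvd_geometric:
  fixes u :: "'a::comm_ring_1 fps"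
  assumes "fps_X dvd u"
  shows "fps_X ^ N dvd (\<Sum>k<N. u ^ k) - ring_inverse (1 - u)"
proof -
  define v where "v = ring_inverse (1 - u)"
  have "fps_nth u 0 = 0"
    using assms by (auto elim!: dvdE)
  then have v: "(1 - u) * v = 1"
    unfolding v_def by (intro ring_inverse_fps) simp
  have "(\<Sum>k<N. u ^ k) - v = v * ((1 - u) * (\<Sum>k<N. u ^ k)) - v"
    using v by (simp add: mult.assoc[symmetric] mult.commute)
  also have "\<dots> = - (v * u ^ N)"
    unfolding one_diff_power_eq[symmetric] by (simp add: algebra_simps)
  finally show ?thesis
    using assms by (simp add: v_def dvd_power_same)
qed

text \<open>Expanding a product of truncated series gives a sum over a box of exponent
  vectors.\<close>

lemma
  shows finite_tuples_less: "finite {c \<in> tuples r. \<forall>i\<in>{1..r}. c i < N}"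
    and sum_tuples_less: "(\<Sum>c \<in> {c \<in> tuples r. \<forall>i\<in>{1..r}. c i < N}. \<Prod>i = 1..r. f i (c i)) =
      (\<Prod>i = 1..r. \<Sum>k<N. f i k :: 'a::comm_semiring_1)"
proof -
  define A where "A = {c \<in> tuples r. \<forall>i\<in>{1..r}. c i < N}"
  define B where "B = (\<Pi>\<^sub>E i\<in>{1..r}. {..<N})"
  \<comment> \<open>Translates functions that are \<open>undefined\<close> outside
    \<open>{1..r}\<close>, as in \<open>B\<close>, into tuples that are \<open>0\<close>
    there.\<close>
  define e where "e p i = (if i \<in> {1..r} then p i else 0)" for p :: "nat \<Rightarrow> nat" and i
  have bij: "bij_betw e B A"
    by (rule bij_betw_byWitness[where f' = "\<lambda>c. restrict c {1..r}"])
      (auto simp: e_def A_def B_def tuples_def fun_eq_iff PiE_def Pi_def extensional_def)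
  have "finite B" unfolding B_def by (intro finite_PiE) auto
  then show "finite {c \<in> tuples r. \<forall>i\<in>{1..r}. c i < N}"
    using bij_betw_finite[OF bij] by (simp add: A_def)
  have "(\<Sum>c\<in>A. \<Prod>i = 1..r. f i (c i)) = (\<Sum>p\<in>B. \<Prod>i = 1..r. f i (e p i))"
    by (rule sum.reindex_bij_betw[OF bij, symmetric])
  also have "\<dots> = (\<Sum>p\<in>B. \<Prod>i = 1..r. f i (p i))"
    by (intro sum.cong prod.cong) (auto simp: e_def)
  also have "\<dots> = (\<Prod>i = 1..r. \<Sum>k<N. f i k)"
    unfolding B_def by (rule prod_sum_PiE[symmetric]) auto
  finally show "(\<Sum>c \<in> {c \<in> tuples r. \<forall>i\<in>{1..r}. c i < N}. \<Prod>i = 1..r. f i (c i)) =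
      (\<Prod>i = 1..r. \<Sum>k<N. f i k)"
    by (simp add: A_def)
qed

text \<open>For the coefficient at \<open>n\<close>, the box of exponents below \<open>Suc n\<close>
  suffices: any further term has an exponent of at least \<open>Suc n\<close> and is divisible by
  \<open>fps_X ^ Suc n\<close>.\<close>

lemma has_sum_prod_geometric_fps:
  fixes u :: "nat \<Rightarrow> 'a::comm_ring_1 fps"
  assumes "\<And>i. i \<in> {1..r} \<Longrightarrow> fps_X dvd u i"
  shows "((\<lambda>c. z * (\<Prod>i = 1..r. u i ^ c i)) has_sum (z * (\<Prod>i = 1..r. ring_inverse (1 - u i))))
    (tuples r)"
proof (rule has_sum_fpsI)
  fix n
  define N where "N = Suc n"
  define B where "B = {c \<in> tuples r. \<forall>i\<in>{1..r}. c i < N}"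
  define p where "p c = (\<Prod>i = 1..r. u i ^ c i)" for c
  define v where "v = (\<Prod>i = 1..r. ring_inverse (1 - u i))"
  have eq: "fps_nth (\<Sum>c\<in>F. z * p c) n = fps_nth (z * v) n"
    if F: "finite F" "B \<subseteq> F" "F \<subseteq> tuples r" for F
  proof -
    have "(\<Sum>c\<in>B. p c) = (\<Prod>i = 1..r. \<Sum>k<N. u i ^ k)"
      unfolding B_def p_def by (rule sum_tuples_less)
    then have "fps_X ^ N dvd (\<Sum>c\<in>B. p c) - v"
      by (simp only: v_def) (intro dvd_prod_diff fps_X_power_dvd_geometric assms)
    moreover have "fps_X ^ N dvd (\<Sum>c\<in>F - B. p c)"
    proof (rule dvd_sum)
      fix c assume "c \<in> F - B"
      with F obtain i where i: "i \<in> {1..r}" "N \<le> c i"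
        by (auto simp: B_def not_less)
      have "fps_X ^ N dvd u i ^ N"
        using assms[OF i(1)] by (rule dvd_power_same)
      also have "u i ^ N dvd u i ^ c i"
        using i(2) by (rule le_imp_power_dvd)
      also have "\<dots> dvd p c"
        unfolding p_def using i(1) by (intro dvd_prodI) auto
      finally show "fps_X ^ N dvd p c" .
    qed
    ultimately have "fps_X ^ N dvd z * ((\<Sum>c\<in>F - B. p c) + ((\<Sum>c\<in>B. p c) - v))"
      by (intro dvd_mult dvd_add)
    also have "\<dots> = (\<Sum>c\<in>F. z * p c) - z * v"
      unfolding sum.subset_diff[OF F(2,1)] sum_distrib_left[symmetric] by (simp add: algebra_simps)
    finally show ?thesis
      using fps_X_power_dvd_nth unfolding N_def by fastforce
  qed
  show "\<exists>F. finite F \<and> F \<subseteq> tuples r \<and> (\<forall>F'. finite F' \<longrightarrow> F \<subseteq> F' \<longrightarrow> F' \<subseteq> tuples r \<longrightarrow>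
      fps_nth (\<Sum>c\<in>F'. z * (\<Prod>i = 1..r. u i ^ c i)) n =
      fps_nth (z * (\<Prod>i = 1..r. ring_inverse (1 - u i))) n)"
  proof (intro exI conjI allI impI)
    show "finite B" unfolding B_def by (rule finite_tuples_less)
    show "B \<subseteq> tuples r" by (auto simp: B_def)
  qed (use eq in \<open>simp add: p_def v_def\<close>)
qed

section \<open>Summation over the orbit\<close>

lemma freely_generated_by_nonzero:
  assumes "freely_generated_by M r a" "i \<in> {1..r}"
  shows "a i \<noteq> (\<lambda>j. 0)"
proof
  assume 0: "a i = (\<lambda>j. 0)"
  \<comment> \<open>The unit vector at \<open>i\<close> would give the same combination as the zero
    vector.\<close>
  define c :: "nat \<Rightarrow> nat" where "c k = of_bool (k = i)" for k
  have "(\<lambda>j. \<Sum>k = 1..r. c k * a k j) = (\<lambda>j. \<Sum>k = 1..r. 0 * a k j)"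
    using 0 by (intro ext sum.cong) (auto simp: c_def)
  moreover have "c \<in> tuples r" "(\<lambda>k. 0) \<in> tuples r"
    using assms(2) by (auto simp: c_def tuples_def)
  ultimately have "c = (\<lambda>k. 0)"
    using assms(1) unfolding freely_generated_by_def
    by (auto dest!: bij_betw_imp_inj_on elim!: inj_onD)
  then show False
    by (auto simp: c_def fun_eq_iff)
qed

theorem theorem5p4:
  fixes d r :: nat and x0 :: "nat \<Rightarrow> nat" and \<Gamma>' :: "(nat \<Rightarrow> nat) set"
    and a :: "nat \<Rightarrow> nat \<Rightarrow> nat"
  assumes "d \<ge> 1"
    and "x0 \<in> tuples d"
    and "\<Gamma>' \<subseteq> tuples d"
    and "\<And>i. i \<in> {1..r} \<Longrightarrow> a i \<in> tuples d"
    and "freely_generated_by \<Gamma>' r a"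
  shows "(cont d has_sum (cont d x0 * (\<Prod>i = 1..r. ring_inverse (1 - cont_\<Gamma> d (a i)))))
           (orbit d \<Gamma>' x0)"
proof -
  define \<phi> where "\<phi> c = (\<lambda>j. \<Sum>i = 1..r. c i * a i j)" for c
  have \<phi>: "bij_betw \<phi> (tuples r) \<Gamma>'"
    using assms(5) by (simp add: freely_generated_by_def \<phi>_def[abs_def])
  have "bij_betw (\<lambda>b. g_pow d b x0) \<Gamma>' (orbit d \<Gamma>' x0)"
    using inj_on_subset[OF inj_on_g_pow[OF assms(1,2)] assms(3)]
    by (auto simp: bij_betw_def orbit_def)
  \<comment> \<open>Freeness and the injectivity of the action make each orbit element arise from
    exactly one coefficient vector \<open>c\<close>, so the sum can be taken over
    \<open>tuples r\<close>.\<close>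
  from bij_betw_trans[OF \<phi> this]
  have bij: "bij_betw (\<lambda>c. g_pow d (\<phi> c) x0) (tuples r) (orbit d \<Gamma>' x0)"
    by (simp add: o_def)
  have "cont d (g_pow d (\<phi> c) x0) = cont d x0 * (\<Prod>i = 1..r. cont_\<Gamma> d (a i) ^ c i)" for c
    unfolding cont_g_pow[OF assms(1)] \<phi>_def cont_\<Gamma>_sum by (rule mult.commute)
  moreover have "((\<lambda>c. cont d x0 * (\<Prod>i = 1..r. cont_\<Gamma> d (a i) ^ c i)) has_sum
      (cont d x0 * (\<Prod>i = 1..r. ring_inverse (1 - cont_\<Gamma> d (a i))))) (tuples r)"
    by (intro has_sum_prod_geometric_fps fps_X_dvd_cont_\<Gamma> assms(4)
        freely_generated_by_nonzero[OF assms(5)])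
  ultimately show ?thesis
    by (simp flip: has_sum_reindex_bij_betw[OF bij])
qed

end
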